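(* Suppose that Assumption 1 (stated in the context) holds for $\mathbf v\in\mathbb C^N$ and $\mathbf M_0\in\mathbb H^N$. Let $\hat{\boldsymbol\mu}\in\mathcal D(\mathbf v)$ be an arbitrary dual SDP certificate for $\mathbf v$. Let $\boldsymbol\eta\in\mathbb R^M$ be the noise vector, $z_j=\mathbf v^*\mathbf M_j\mathbf v+\eta_j$ for $j\in\mathcal M$, and let $(\mathbf X^{\mathrm{opt}},\boldsymbol\nu^{\mathrm{opt}})$ denote an optimal solution of the penalized convex program $$\min_{\mathbf X\in\mathbb H^N,\ \boldsymbol\nu\in\mathbb R^M}\ \rho f_{\mathrm{WLAV}}(\boldsymbol\nu)+\mathrm{Tr}(\mathbf M_0\mathbf X)\quad\text{subject to}\quad \mathrm{Tr}(\mathbf M_j\mathbf X)+\nu_j=z_j\ \ \forall j\in\mathcal M,\quad \mathbf X\succeq\mathbf 0,$$ with a coefficient $\rho>0$ satisfying $\rho\ge\max_{j\in\mathcal M}|\sigma_j\hat\mu_j|$. Then there exists a scalar $\beta>0$ such that $$\zeta:=\frac{\|\mathbf X^{\mathrm{opt}}-\beta\mathbf v\mathbf v^*\|_F}{\sqrt{N\times\mathrm{Tr}(\mathbf X^{\mathrm{opt}})}}\le 2\sqrt{\frac{\rho\, f_{\mathrm{WLAV}}(\boldsymbol\eta)}{N\lambda}},$$ where $\lambda$ is the second smallest eigenvalue of the matrix $\mathbf H(\hat{\boldsymbol\mu})$.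
   Context: $\mathbb H^N$ denotes the $N\times N$ complex Hermitian matrices ($N\ge2$), $(\cdot)^*$ the conjugate transpose (conjugate, for scalars), $\|\cdot\|_F$ the Frobenius norm, and $\measuredangle x$ the angle of a nonzero complex number $x$; angle differences are in degrees and understood modulo $360^\circ$. The ratio defining $\zeta$ presupposes $\mathrm{Tr}(\mathbf X^{\mathrm{opt}})>0$. Network. $\mathcal G=(\mathcal N,\mathcal L)$ is the (connected) graph of a power network with bus set $\mathcal N=\{1,\dots,N\}$ and line set $\mathcal L$. $\mathcal G'=(\mathcal N,\mathcal L')$ is a subgraph of $\mathcal G$ containing a spanning tree of $\mathcal G$ (with at most one line between any two buses). Each line $l\in\mathcal L'$ is written $l=(s,t)$, where $s$ is its "from" end and $t$ its "to" end, and has branch admittance $y_{st}\in\mathbb C$. For $l=(s,t)\in\mathcal L'$, the matrix $\mathbf Y_{l,p_f}\in\mathbb H^N$ has only the following possibly nonzero entries: $\mathbf Y_{l,p_f}(s,t)=\mathbf Y_{l,p_f}(t,s)^*=-y_{st}/2$ and $\mathbf Y_{l,p_f}(s,s)=\mathrm{Re}(y_{st})$. Measurements. $\mathcal M=\{1,\dots,M\}$ with $M=N+|\mathcal L'|$; the lines of $\mathcal L'$ are numbered $1,\dots,|\mathcal L'|$. $\mathbf M_k=\mathbf e_k\mathbf e_k^\top$ for $k=1,\dots,N$ (squared voltage magnitudes) and $\mathbf M_{N+l}=\mathbf Y_{l,p_f}$ for $l\in\mathcal L'$ (active power flow at the "from" end of each line). $\mathbf v$ is the true state. $\sigma_1,\dots,\sigma_M>0$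 are constants and $f_{\mathrm{WLAV}}(\boldsymbol\nu)=\sum_{j=1}^M|\nu_j|/\sigma_j$. Dual certificates. $\mathbf H(\boldsymbol\mu):=\mathbf M_0+\sum_{j=1}^M\mu_j\mathbf M_j$. A vector $\boldsymbol\mu\in\mathbb R^M$ is a dual SDP certificate for $\mathbf v$ if $\mathbf H(\boldsymbol\mu)\succeq\mathbf 0$, $\mathbf H(\boldsymbol\mu)\mathbf v=\mathbf 0$ and $\mathrm{rank}(\mathbf H(\boldsymbol\mu))=N-1$; $\mathcal D(\mathbf v)$ is the set of all of them. The sparsity graph of $\mathbf W\in\mathbb H^N$ is the simple undirected graph on $\{1,\dots,N\}$ in which distinct $i,j$ are adjacent iff $W_{i,j}\neq0$. Assumption 1. The edge set of the sparsity graph of $\mathbf M_0$ coincides with $\mathcal L'$, and, with $M_{0;st}$ denoting the $(s,t)$ entry of $\mathbf M_0$, for all $(s,t)\in\mathcal L'$: - $-180^\circ<\measuredangle M_{0;st}-\measuredangle y_{st}<0$; - $0<(\measuredangle v_s-\measuredangle v_t)-\measuredangle y_{st}<180^\circ$; - $(\measuredangle v_s-\measuredangle v_t)-\measuredangle M_{0;st}\neq 0$ or $180^\circ$ (i.e. it equals neither value). Equivalently: $\mathrm{Im}(M_{0;st}y_{st}^* )<0$, $\mathrm{Im}(v_sv_t^*y_{st}^* )>0$, $\mathrm{Im}(v_sv_t^*M_{0;st}^* )\ne0$. *)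

theory Defs
  imports
    "Jordan_Normal_Form.Schur_Decomposition"
    "Jordan_Normal_Form.DL_Rank"
    "Graph_Theory.Digraph_Component"
begin

text \<open>
  Buses are numbered from 0 to \<open>N - 1\<close> and measurements from 0 to \<open>M - 1\<close>, following the
  indexing of vectors and matrices. A network is a digraph with one arc per line, whose tail
  and head are the ``from'' and ``to'' ends; parallel lines are allowed. The orientation plays
  no role for connectedness (\<^const>\<open>Digraph_Component.connected\<close> symmetrizes the graph) nor for
  cycles. The latter is why the library's \<open>forest\<close> and \<open>spanning_tree\<close>, which only exclude
  directed cycles, are not used.
\<close>

definition undirected_cycle :: "('a, 'l) pre_digraph \<Rightarrow> 'l list \<Rightarrow> 'a list \<Rightarrow> bool" where
  "undirected_cycle G es us \<longleftrightarrow>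
     es \<noteq> [] \<and> length us = length es \<and> distinct es \<and> distinct us \<and> set es \<subseteq> arcs G \<and>
     (\<forall>i < length es. {tail G (es ! i), head G (es ! i)} = {us ! i, us ! (Suc i mod length es)})"

definition undirected_spanning_tree :: "('a, 'l) pre_digraph \<Rightarrow> ('a, 'l) pre_digraph \<Rightarrow> bool" where
  "undirected_spanning_tree T G \<longleftrightarrow>
     spanning T G \<and> Digraph_Component.connected T \<and> (\<nexists>es us. undirected_cycle T es us)"

definition no_parallel_lines :: "('a, 'l) pre_digraph \<Rightarrow> bool" where
  "no_parallel_lines G \<longleftrightarrow> inj_on (\<lambda>l. {tail G l, head G l}) (arcs G)"

definition power_network ::
  "nat \<Rightarrow> (nat, 'l) pre_digraph \<Rightarrow> (nat, 'l) pre_digraph \<Rightarrow> bool" where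
  "power_network N G G' \<longleftrightarrow>
     fin_digraph G \<and> loopfree_digraph G \<and> verts G = {..<N} \<and> Digraph_Component.connected G \<and>
     subgraph G' G \<and> (\<exists>T. undirected_spanning_tree T G \<and> subgraph T G') \<and> no_parallel_lines G'"

definition hermitian_mat :: "nat \<Rightarrow> complex mat \<Rightarrow> bool" where
  "hermitian_mat N A \<longleftrightarrow> A \<in> carrier_mat N N \<and> mat_adjoint A = A"

definition psd_mat :: "nat \<Rightarrow> complex mat \<Rightarrow> bool" where
  "psd_mat N A \<longleftrightarrow>
     hermitian_mat N A \<and> (\<forall>x \<in> carrier_vec N. 0 \<le> Re ((A *\<^sub>v x) \<bullet>c x))"

definition mat_trace :: "complex mat \<Rightarrow> complex" where
  "mat_trace A = (\<Sum>i < dim_row A. A $$ (i, i))"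

definition frobenius_norm :: "complex mat \<Rightarrow> real" where
  "frobenius_norm A = sqrt (\<Sum>i < dim_row A. \<Sum>j < dim_col A. (cmod (A $$ (i, j)))\<^sup>2)"

definition outer_prod :: "complex vec \<Rightarrow> complex vec \<Rightarrow> complex mat" where
  "outer_prod u w = mat (dim_vec u) (dim_vec w) (\<lambda>(i, j). u $ i * cnj (w $ j))"

text \<open>
  The roots of the characteristic polynomial with multiplicity, in increasing order. For
  Hermitian matrices they are real, so that \<^const>\<open>Re\<close> is just a coercion.
\<close>

definition sorted_eigenvalues :: "complex mat \<Rightarrow> real list" where
  "sorted_eigenvalues A = sorted_list_of_multiset (image_mset Re (proots (char_poly A)))"

definition second_smallest_eigenvalue :: "complex mat \<Rightarrow> real" where
  "second_smallest_eigenvalue A = sorted_eigenvalues A ! 1"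

definition flow_mat ::
  "nat \<Rightarrow> (nat, 'l) pre_digraph \<Rightarrow> ('l \<Rightarrow> complex) \<Rightarrow> 'l \<Rightarrow> complex mat" where
  "flow_mat N G y l = mat N N (\<lambda>(i, j).
     if i = tail G l \<and> j = head G l then - y l / 2
     else if i = head G l \<and> j = tail G l then cnj (- y l / 2)
     else if i = tail G l \<and> j = tail G l then of_real (Re (y l))
     else 0)"

text \<open>The list \<open>ls\<close> enumerates the measured lines.\<close>

definition meas_mat ::
  "nat \<Rightarrow> (nat, 'l) pre_digraph \<Rightarrow> ('l \<Rightarrow> complex) \<Rightarrow> 'l list \<Rightarrow> nat \<Rightarrow> complex mat" where
  "meas_mat N G y ls j =
     (if j < N then outer_prod (unit_vec N j) (unit_vec N j) else flow_mat N G y (ls ! (j - N)))"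

text \<open>The quadratic form is real because measurement matrices are Hermitian.\<close>

definition noisy_meas ::
  "nat \<Rightarrow> (nat \<Rightarrow> complex mat) \<Rightarrow> complex vec \<Rightarrow> real vec \<Rightarrow> real vec" where
  "noisy_meas M Ms v \<eta> = vec M (\<lambda>j. Re ((Ms j *\<^sub>v v) \<bullet>c v) + \<eta> $ j)"

definition f_WLAV :: "nat \<Rightarrow> (nat \<Rightarrow> real) \<Rightarrow> real vec \<Rightarrow> real" where
  "f_WLAV M \<sigma> \<nu> = (\<Sum>j < M. \<bar>\<nu> $ j\<bar> / \<sigma> j)"

definition dual_mat ::
  "nat \<Rightarrow> nat \<Rightarrow> complex mat \<Rightarrow> (nat \<Rightarrow> complex mat) \<Rightarrow> real vec \<Rightarrow> complex mat" where
  "dual_mat N M M0 Ms \<mu> =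
     mat N N (\<lambda>(i, k). M0 $$ (i, k) + (\<Sum>j < M. of_real (\<mu> $ j) * Ms j $$ (i, k)))"

definition dual_certificate_set ::
  "nat \<Rightarrow> nat \<Rightarrow> complex mat \<Rightarrow> (nat \<Rightarrow> complex mat) \<Rightarrow> complex vec \<Rightarrow> real vec set" where
  "dual_certificate_set N M M0 Ms v =
     {\<mu> \<in> carrier_vec M.
        psd_mat N (dual_mat N M M0 Ms \<mu>) \<and>
        dual_mat N M M0 Ms \<mu> *\<^sub>v v = 0\<^sub>v N \<and>
        vec_space.rank N (dual_mat N M M0 Ms \<mu>) = N - 1}"

definition penalized_feasible ::
  "nat \<Rightarrow> nat \<Rightarrow> (nat \<Rightarrow> complex mat) \<Rightarrow> real vec \<Rightarrow> complex mat \<times> real vec \<Rightarrow> bool" where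
  "penalized_feasible N M Ms z = (\<lambda>(X, \<nu>).
     hermitian_mat N X \<and> \<nu> \<in> carrier_vec M \<and>
     (\<forall>j < M. Re (mat_trace (Ms j * X)) + \<nu> $ j = z $ j) \<and> psd_mat N X)"

definition penalized_objective ::
  "nat \<Rightarrow> (nat \<Rightarrow> real) \<Rightarrow> complex mat \<Rightarrow> real \<Rightarrow> complex mat \<times> real vec \<Rightarrow> real" where
  "penalized_objective M \<sigma> M0 \<rho> = (\<lambda>(X, \<nu>). \<rho> * f_WLAV M \<sigma> \<nu> + Re (mat_trace (M0 * X)))"

definition sparsity_edges :: "nat \<Rightarrow> complex mat \<Rightarrow> nat set set" where
  "sparsity_edges N W = {{i, j} | i j. i < N \<and> j < N \<and> i \<noteq> j \<and> W $$ (i, j) \<noteq> 0}"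

definition angle_deg :: "complex \<Rightarrow> real" where
  "angle_deg x = Arg x * 180 / pi"

definition deg_between :: "real \<Rightarrow> real \<Rightarrow> real \<Rightarrow> bool" where
  "deg_between a d b \<longleftrightarrow> (\<exists>k::int. a < d + 360 * of_int k \<and> d + 360 * of_int k < b)"

definition deg_eq :: "real \<Rightarrow> real \<Rightarrow> bool" where
  "deg_eq d c \<longleftrightarrow> (\<exists>k::int. d = c + 360 * of_int k)"

text \<open>
  Angles are only meaningful for nonzero numbers (\<^const>\<open>Arg\<close> is 0 at 0), so the nonvanishing of
  the quantities involved is part of the assumption; for the entries of \<open>M0\<close> it already follows
  from the condition on the sparsity graph.
\<close>

definition angle_conditions :: "complex \<Rightarrow> complex \<Rightarrow> complex \<Rightarrow> complex \<Rightarrow> bool" where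
  "angle_conditions m y vs vt \<longleftrightarrow>
     m \<noteq> 0 \<and> y \<noteq> 0 \<and> vs \<noteq> 0 \<and> vt \<noteq> 0 \<and>
     deg_between (-180) (angle_deg m - angle_deg y) 0 \<and>
     deg_between 0 ((angle_deg vs - angle_deg vt) - angle_deg y) 180 \<and>
     \<not> deg_eq ((angle_deg vs - angle_deg vt) - angle_deg m) 0 \<and>
     \<not> deg_eq ((angle_deg vs - angle_deg vt) - angle_deg m) 180"

definition assumption1 ::
  "nat \<Rightarrow> (nat, 'l) pre_digraph \<Rightarrow> ('l \<Rightarrow> complex) \<Rightarrow> complex mat \<Rightarrow> complex vec \<Rightarrow> bool" where
  "assumption1 N G y M0 v \<longleftrightarrow>
     sparsity_edges N M0 = (\<lambda>l. {tail G l, head G l}) ` arcs G \<and>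
     (\<forall>l \<in> arcs G.
        angle_conditions (M0 $$ (tail G l, head G l)) (y l) (v $ tail G l) (v $ head G l))"

lemma deg_sin_sign:
  fixes r d :: real
  assumes r: "r > 0"
  shows "deg_between 0 d 180 \<longleftrightarrow> 0 < r * sin (d * pi / 180)" (is ?A)
    and "deg_between (-180) d 0 \<longleftrightarrow> r * sin (d * pi / 180) < 0" (is ?B)
    and "deg_eq d 0 \<or> deg_eq d 180 \<longleftrightarrow> r * sin (d * pi / 180) = 0" (is ?C)
proof -
  have per: "sin ((d + 360 * of_int k) * pi / 180) = sin (d * pi / 180)" for k :: int
  proof -
    have "(d + 360 * of_int k) * pi / 180 = d * pi / 180 + of_int k * (2 * pi)"
      by (simp add: field_simps)
    then show ?thesis
      by (simp only: sin_add mult.commute[of _ "2 * pi"] sin_int_2pin cos_int_2pin)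
  qed
  define k where "k = - \<lfloor>(d + 180) / 360\<rfloor>"
  define e where "e = d + 360 * of_int k"
  have "of_int (-k) \<le> (d + 180) / 360" "(d + 180) / 360 < of_int (-k) + 1"
    unfolding k_def by linarith+
  then have e: "-180 \<le> e" "e < 180" by (simp_all add: e_def field_simps)
  have pos: "0 < sin (x * pi / 180)" if "0 < x" "x < 180" for x :: real
    using that by (intro sin_gt_zero) (simp_all add: field_simps)
  have neg: "sin (x * pi / 180) < 0" if "-180 < x" "x < 0" for x :: real
    using pos[of "-x"] that by simp
  have dA: "deg_between 0 d 180" if "0 < e" using that e by (auto simp: deg_between_def e_def)
  have dB: "deg_between (-180) d 0" if "-180 < e" "e < 0"
    using that by (auto simp: deg_between_def e_def)
  have dC: "deg_eq d 0 \<or> deg_eq d 180" if "e = -180 \<or> e = 0"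
    using that
  proof
    assume "e = -180"
    then have "d = 180 + 360 * of_int (- k - 1)" by (simp add: e_def)
    then show ?thesis unfolding deg_eq_def by blast
  next
    assume "e = 0"
    then have "d = 0 + 360 * of_int (- k)" by (simp add: e_def)
    then show ?thesis unfolding deg_eq_def by blast
  qed
  have sA: "0 < sin (d * pi / 180)" if "deg_between 0 d 180"
    using that pos[of "d + 360 * of_int _"] per unfolding deg_between_def by force
  have sB: "sin (d * pi / 180) < 0" if "deg_between (-180) d 0"
    using that neg[of "d + 360 * of_int _"] per unfolding deg_between_def by force
  have sC: "sin (d * pi / 180) = 0" if h: "deg_eq d 0 \<or> deg_eq d 180"
  proof -
    obtain c k' where c: "c = 0 \<or> c = 180" and d: "d = c + 360 * of_int (k' :: int)"
      using h unfolding deg_eq_def by blast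
    have "d * pi / 180 = (if c = 0 then of_int (2 * k') else of_int (2 * k' + 1)) * pi"
      using c d by (auto simp: field_simps)
    then show ?thesis by (metis sin_zero_iff_int2)
  qed
  have tri: "0 < e \<or> (-180 < e \<and> e < 0) \<or> (e = -180 \<or> e = 0)" using e by linarith
  have "?A \<and> ?B \<and> ?C"
    using tri sA sB sC dA dB dC r
    by (force simp: zero_less_mult_iff mult_less_0_iff)+
  then show ?A ?B ?C by blast+
qed

lemma Im_mult_cnj_angle:
  "Im (a * cnj b) = cmod a * cmod b * sin ((angle_deg a - angle_deg b) * pi / 180)"
  "Im (a * cnj b * cnj c) =
     cmod a * cmod b * cmod c * sin ((angle_deg a - angle_deg b - angle_deg c) * pi / 180)"
proof -
  have pol: "x = of_real (cmod x) * cis (Arg x)" for x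
    by (metis rcis_cmod_Arg rcis_def)
  have polc: "cnj x = of_real (cmod x) * cis (- Arg x)" for x
    by (subst pol) (simp add: cis_cnj)
  have "a * cnj b = of_real (cmod a * cmod b) * (cis (Arg a) * cis (- Arg b))"
    by (subst pol[of a], subst polc[of b]) (simp only: of_real_mult mult_ac)
  then have prod: "a * cnj b = of_real (cmod a * cmod b) * cis (Arg a - Arg b)"
    by (simp add: cis_mult)
  have ang: "(angle_deg a - angle_deg b) * pi / 180 = Arg a - Arg b"
    by (simp add: angle_deg_def field_simps)
  show "Im (a * cnj b) = cmod a * cmod b * sin ((angle_deg a - angle_deg b) * pi / 180)"
    unfolding ang prod by simp
  have "a * cnj b * cnj c =
      of_real (cmod a * cmod b * cmod c) * (cis (Arg a) * cis (- Arg b) * cis (- Arg c))"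
    by (subst pol[of a], subst polc[of b], subst polc[of c]) (simp only: of_real_mult mult_ac)
  then have prod: "a * cnj b * cnj c =
      of_real (cmod a * cmod b * cmod c) * cis (Arg a - Arg b - Arg c)"
    by (simp add: cis_mult)
  have ang: "(angle_deg a - angle_deg b - angle_deg c) * pi / 180 = Arg a - Arg b - Arg c"
    by (simp add: angle_deg_def field_simps)
  show "Im (a * cnj b * cnj c) =
      cmod a * cmod b * cmod c * sin ((angle_deg a - angle_deg b - angle_deg c) * pi / 180)"
    unfolding ang prod by simp
qed

text \<open>The angle conditions in terms of signs of imaginary parts.\<close>

lemma angle_conditions_iff:
  "angle_conditions m y vs vt \<longleftrightarrow>
     Im (m * cnj y) < 0 \<and> Im (vs * cnj vt * cnj y) > 0 \<and> Im (vs * cnj vt * cnj m) \<noteq> 0"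
proof (cases "m \<noteq> 0 \<and> y \<noteq> 0 \<and> vs \<noteq> 0 \<and> vt \<noteq> 0")
  case True
  then have "cmod m * cmod y > 0" "cmod vs * cmod vt * cmod y > 0" "cmod vs * cmod vt * cmod m > 0"
    by simp_all
  note r = deg_sin_sign(2)[OF this(1)] deg_sin_sign(1)[OF this(2)] deg_sin_sign(3)[OF this(3)]
  from True show ?thesis
    unfolding angle_conditions_def Im_mult_cnj_angle(2)
    unfolding Im_mult_cnj_angle(1) r[symmetric] by blast
next
  case False
  then show ?thesis by (auto simp: angle_conditions_def)
qed

end

theory Submission
  imports Defs
begin

text \<open>
  Let \<open>H\<close> be the dual matrix of the certificate, \<open>X\<close> the matrix part of the optimal solution, \<open>T\<close>
  its trace and \<open>a = v* X v / \<parallel>v\<parallel>\<^sup>2\<close>. The proof combines three estimates.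

  Optimality (\<open>trace_dual_mat_optimal_le\<close>): comparing the optimal point with the feasible point
  \<open>(v v*, \<eta>)\<close>, and using that \<open>H\<close> annihilates \<open>v\<close> and that \<open>\<rho>\<close> dominates the weighted
  multipliers, gives \<open>Tr (H X) \<le> 2 * \<rho> * f_WLAV \<eta>\<close>.

  Spectral gap (\<open>psd_spectral_gap\<close>): \<open>H\<close> is psd and its null space is spanned by \<open>v\<close>, so the part
  of \<open>X\<close> orthogonal to \<open>v\<close> is weighted at least by the second smallest eigenvalue:
  \<open>\<lambda> * (T - a) \<le> Tr (H X)\<close>. That \<open>\<lambda> > 0\<close> is the rank condition
  (\<open>second_smallest_eigenvalue_pos\<close>).

  Geometry (\<open>psd_near_rank_one\<close>): a psd matrix has Frobenius norm at most its trace, so for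
  \<open>\<beta> = T / \<parallel>v\<parallel>\<^sup>2\<close> one gets \<open>\<parallel>X - \<beta> v v*\<parallel>\<^sup>2 \<le> T\<^sup>2 - 2 * T * a + T\<^sup>2 = 2 * T * (T - a)\<close>.

  Chaining them gives \<open>\<parallel>X - \<beta> v v*\<parallel>\<^sup>2 \<le> 4 * T * \<rho> * f_WLAV \<eta> / \<lambda>\<close>, which is the claim after
  division by \<open>N * T\<close>. The network supplies \<open>v \<noteq> 0\<close>
  (\<open>power_network_state_nonzero\<close>). The linear algebra rests on the
  spectral theorem for Hermitian matrices, proved here by unitary deflation and stated with the
  increasing list of eigenvalues that defines \<open>\<lambda>\<close>.
\<close>

section \<open>Adjoints and unitary matrices\<close>

definition unitary_mat :: "nat \<Rightarrow> complex mat \<Rightarrow> bool" where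
  "unitary_mat n U \<longleftrightarrow>
     U \<in> carrier_mat n n \<and> mat_adjoint U * U = 1\<^sub>m n \<and> U * mat_adjoint U = 1\<^sub>m n"

lemma mat_adjoint_index [simp]:
  "i < dim_col A \<Longrightarrow> j < dim_row A \<Longrightarrow> mat_adjoint A $$ (i, j) = conjugate (A $$ (j, i))"
  by (simp add: mat_adjoint_def mat_of_rows_index)

lemma mat_adjoint_dim [simp]:
  "dim_row (mat_adjoint A) = dim_col A" "dim_col (mat_adjoint A) = dim_row A"
  by (simp_all add: mat_adjoint_def)

lemma mat_adjoint_carrier [simp]:
  "A \<in> carrier_mat m n \<Longrightarrow> mat_adjoint A \<in> carrier_mat n m"
  by auto

lemma mat_adjoint_mult:
  fixes A B :: "complex mat"
  assumes "A \<in> carrier_mat m n" "B \<in> carrier_mat n k"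
  shows "mat_adjoint (A * B) = mat_adjoint B * mat_adjoint A"
proof (rule eq_matI)
  fix i j assume ij: "i < dim_row (mat_adjoint B * mat_adjoint A)"
    "j < dim_col (mat_adjoint B * mat_adjoint A)"
  then show "mat_adjoint (A * B) $$ (i, j) = (mat_adjoint B * mat_adjoint A) $$ (i, j)"
    using assms by (auto simp: scalar_prod_def mult.commute intro!: sum.cong)
qed (use assms in auto)

lemma mat_adjoint_adjoint [simp]: "mat_adjoint (mat_adjoint A) = (A :: complex mat)"
  by (rule eq_matI) auto

lemma unitary_matI:
  assumes "U \<in> carrier_mat n n" "mat_adjoint U * U = 1\<^sub>m n"
  shows "unitary_mat n U"
  using assms mat_mult_left_right_inverse[of "mat_adjoint U" n U]
  by (auto simp: unitary_mat_def)

lemma unitary_mat_mult: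
  assumes "unitary_mat n U" "unitary_mat n W"
  shows "unitary_mat n (U * W)"
proof (rule unitary_matI)
  have c: "U \<in> carrier_mat n n" "W \<in> carrier_mat n n"
    "mat_adjoint U \<in> carrier_mat n n" "mat_adjoint W \<in> carrier_mat n n"
    using assms by (auto simp: unitary_mat_def)
  show "U * W \<in> carrier_mat n n" using c by simp
  have "mat_adjoint (U * W) * (U * W) = mat_adjoint W * (mat_adjoint U * U) * W"
    using c by (simp add: mat_adjoint_mult[of _ n n _ n] mult_carrier_mat[of _ n n _ n] assoc_mult_mat[of _ n n _ n _ n])
  then show "mat_adjoint (U * W) * (U * W) = 1\<^sub>m n"
    using assms c by (simp add: unitary_mat_def)
qed

text \<open>
  Complete \<open>v\<close> to a basis and apply Gram-Schmidt, which keeps the first vector; dividing each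
  resulting column by its norm makes the matrix unitary.
\<close>

lemma unitary_mat_with_first_column:
  assumes v: "v \<in> carrier_vec n" and v0: "v \<noteq> 0\<^sub>v n"
  obtains W c where "unitary_mat n W" "col W 0 = c \<cdot>\<^sub>v v"
proof -
  interpret cof_vec_space n "TYPE(complex)" .
  define b where "b = basis_completion v"
  note bc = basis_completion[OF v v0, folded b_def]
  define ws where "ws = gram_schmidt n b"
  note gs = gram_schmidt_result[OF bc(2,4,5) ws_def]
  have len: "length ws = n" using gs(4) bc(6) by simp
  have n: "0 < n" using v v0 by (cases n) (auto intro: eq_vecI)
  obtain vs where bv: "b = v # vs" using bc(6,7) n by (cases b) auto
  have "hd ws = v" unfolding ws_def bv by (rule gram_schmidt_hd[OF v])
  then have ws0: "ws ! 0 = v" using len n by (cases ws) auto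
  have wsc: "ws ! i \<in> carrier_vec n" if "i < n" for i using gs(3) len that by auto
  define r where "r i = Re (ws ! i \<bullet>c ws ! i)" for i
  have rr: "ws ! i \<bullet>c ws ! i = of_real (r i)" and rpos: "0 < r i" if "i < n" for i
  proof -
    have "0 \<le> ws ! i \<bullet>c ws ! i" by (rule conjugate_square_ge_0_vec)
    moreover have "ws ! i \<bullet>c ws ! i \<noteq> 0"
      using corthogonalD[OF gs(2), of i i] that len by auto
    ultimately show "ws ! i \<bullet>c ws ! i = of_real (r i)" "0 < r i"
      by (auto simp: r_def less_eq_complex_def complex_eq_iff)
  qed
  define W where "W = mat n n (\<lambda>(i, j). ws ! j $ i / of_real (sqrt (r j)))"
  have W: "W \<in> carrier_mat n n" by (simp add: W_def)
  have "mat_adjoint W * W = 1\<^sub>m n"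
  proof (rule eq_matI)
    fix i j assume "i < dim_row (1\<^sub>m n :: complex mat)" "j < dim_col (1\<^sub>m n :: complex mat)"
    then have ij: "i < n" "j < n" by auto
    have "(mat_adjoint W * W) $$ (i, j) =
      (\<Sum>k<n. cnj (ws ! i $ k / of_real (sqrt (r i))) * (ws ! j $ k / of_real (sqrt (r j))))"
      using ij by (auto simp: scalar_prod_def W_def atLeast0LessThan intro!: sum.cong)
    also have "\<dots> = (\<Sum>k<n. ws ! j $ k * cnj (ws ! i $ k)) / of_real (sqrt (r i) * sqrt (r j))"
      by (simp add: sum_divide_distrib mult_ac)
    also have "(\<Sum>k<n. ws ! j $ k * cnj (ws ! i $ k)) = ws ! j \<bullet>c ws ! i"
      using wsc[OF ij(1)] by (auto simp: scalar_prod_def atLeast0LessThan intro!: sum.cong)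
    also have "\<dots> / of_real (sqrt (r i) * sqrt (r j)) = (if i = j then 1 else 0)"
      using corthogonalD[OF gs(2), of j i] ij len rpos[OF ij(1)] rr[OF ij(1)]
      by (auto simp flip: of_real_mult)
    finally show "(mat_adjoint W * W) $$ (i, j) = 1\<^sub>m n $$ (i, j)" using ij by simp
  qed (use W in auto)
  from unitary_matI[OF W this] have "unitary_mat n W" .
  moreover have "col W 0 = (1 / of_real (sqrt (r 0))) \<cdot>\<^sub>v v"
    using n v by (intro eq_vecI) (auto simp: W_def ws0)
  ultimately show thesis by (rule that)
qed

section \<open>The spectral theorem for Hermitian matrices\<close>

lemma hermitian_mat_iff:
  "hermitian_mat n A \<longleftrightarrow>
     A \<in> carrier_mat n n \<and> (\<forall>i<n. \<forall>j<n. A $$ (i, j) = cnj (A $$ (j, i)))"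
proof
  assume h: "hermitian_mat n A"
  then have A: "A \<in> carrier_mat n n" and eq: "mat_adjoint A = A" by (auto simp: hermitian_mat_def)
  have "A $$ (i, j) = cnj (A $$ (j, i))" if "i < n" "j < n" for i j
  proof -
    have "mat_adjoint A $$ (i, j) = cnj (A $$ (j, i))" using A that by simp
    then show ?thesis by (simp add: eq)
  qed
  with A show "A \<in> carrier_mat n n \<and> (\<forall>i<n. \<forall>j<n. A $$ (i, j) = cnj (A $$ (j, i)))" by blast
next
  assume h: "A \<in> carrier_mat n n \<and> (\<forall>i<n. \<forall>j<n. A $$ (i, j) = cnj (A $$ (j, i)))"
  then have A: "A \<in> carrier_mat n n" by blast
  have "mat_adjoint A = A"
  proof (rule eq_matI)
    fix i j assume "i < dim_row A" "j < dim_col A"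
    then have "mat_adjoint A $$ (i, j) = cnj (A $$ (j, i))" "i < n" "j < n" using A by auto
    then show "mat_adjoint A $$ (i, j) = A $$ (i, j)" using h by metis
  qed (use A in auto)
  with h show "hermitian_mat n A" by (auto simp: hermitian_mat_def)
qed

text \<open>
  Deflation, by induction on the number of eigenvalues. In a unitary basis that starts with an
  eigenvector of \<open>e\<close>, the first column vanishes below the diagonal entry \<open>e\<close>. The conjugated
  matrix is still Hermitian because the change of basis is unitary, so its first row vanishes off
  the diagonal too. What remains is a smaller Hermitian block whose characteristic polynomial has
  the remaining roots.
\<close>

lemma hermitian_unitary_diagonalization:
  fixes es :: "real list"
  assumes "hermitian_mat n A"
    and "char_poly A = (\<Prod>e\<leftarrow>es. [:- of_real e, 1:])"
  shows "\<exists>U. unitary_mat n U \<and>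
    A = U * mat_diag n (\<lambda>i. of_real (es ! i)) * mat_adjoint U"
  using assms
proof (induction es arbitrary: n A)
  case Nil
  then have "n = 0"
    using degree_monic_char_poly[of A n] by (auto simp: hermitian_mat_def)
  then show ?case
    using Nil(1) by (intro exI[of _ "1\<^sub>m 0"]) (auto simp: unitary_mat_def hermitian_mat_def)
next
  case (Cons e es)
  define m where "m = n - 1"
  have A: "A \<in> carrier_mat n n" using Cons.prems by (auto simp: hermitian_mat_def)
  let ?p = "\<Prod>e\<leftarrow>es. [:- complex_of_real e, 1:]"
  have cp: "char_poly A = [:- of_real e, 1:] * ?p" using Cons.prems by simp
  have "poly (char_poly A) (of_real e) = 0" by (simp add: cp)
  then have ev: "eigenvalue A (of_real e)" by (simp add: eigenvalue_root_char_poly[OF A])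
  then obtain v where v: "v \<in> carrier_vec n" "v \<noteq> 0\<^sub>v n" "A *\<^sub>v v = of_real e \<cdot>\<^sub>v v"
    using A unfolding eigenvalue_def eigenvector_def by auto
  have n: "n = 1 + m" using eigenvalue_imp_nonzero_dim[OF A ev] by (simp add: m_def)
  obtain W c where W: "unitary_mat n W" and W0: "col W 0 = c \<cdot>\<^sub>v v"
    using unitary_mat_with_first_column[OF v(1,2)] .
  have Wc: "W \<in> carrier_mat n n" "mat_adjoint W \<in> carrier_mat n n"
    and WW: "mat_adjoint W * W = 1\<^sub>m n" "W * mat_adjoint W = 1\<^sub>m n"
    using W by (auto simp: unitary_mat_def)
  define A' where "A' = mat_adjoint W * A * W"
  have A': "A' \<in> carrier_mat n n" using A Wc by (simp add: A'_def mult_carrier_mat[of _ n n _ n])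
  have adjA: "mat_adjoint A = A" using Cons.prems by (simp add: hermitian_mat_def)
  have "mat_adjoint A' = A'"
    using A Wc by (simp add: A'_def mat_adjoint_mult[of _ n n _ n] adjA mult_carrier_mat[of _ n n _ n] assoc_mult_mat[of _ n n _ n _ n])
  then have herm': "A' $$ (i, j) = cnj (A' $$ (j, i))" if "i < n" "j < n" for i j
    using that A' hermitian_mat_iff[of n A'] unfolding hermitian_mat_def by blast
  have A_eq: "A = W * A' * mat_adjoint W"
  proof -
    have "W * A' * mat_adjoint W = (W * mat_adjoint W) * A * (W * mat_adjoint W)"
      using A Wc by (simp add: A'_def mult_carrier_mat[of _ n n _ n] assoc_mult_mat[of _ n n _ n _ n])
    then show ?thesis using WW A by simp
  qed
  have col0: "A' $$ (i, 0) = (if i = 0 then of_real e else 0)" if "i < n" for i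
  proof -
    have n0: "0 < n" using n by simp
    have "col A' 0 = mat_adjoint W *\<^sub>v (A *\<^sub>v col W 0)"
      using A Wc n0 by (simp add: A'_def mult_carrier_mat[of _ n n _ n] col_mult2[of _ n n _ n] assoc_mult_mat_vec[of _ n n _ n])
    also have "A *\<^sub>v col W 0 = of_real e \<cdot>\<^sub>v col W 0"
      using A v by (simp add: W0 mult_mat_vec[of _ n n] smult_smult_assoc mult.commute)
    also have "mat_adjoint W *\<^sub>v (of_real e \<cdot>\<^sub>v col W 0) = of_real e \<cdot>\<^sub>v col (mat_adjoint W * W) 0"
      using Wc n0 by (simp add: mult_mat_vec[of _ n n] col_mult2[of _ n n _ n])
    finally have "col A' 0 $ i = (of_real e \<cdot>\<^sub>v col (1\<^sub>m n) 0) $ i" by (simp add: WW)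
    then show ?thesis using A' that n0 by auto
  qed
  have row0: "A' $$ (0, j) = (if j = 0 then of_real e else 0)" if "j < n" for j
    using herm'[of 0 j] col0[of j] that n by (cases "j = 0") simp_all
  define A3 where "A3 = mat m m (\<lambda>(i, j). A' $$ (Suc i, Suc j))"
  let ?E = "mat 1 1 (\<lambda>_. complex_of_real e)"
  have A3: "A3 \<in> carrier_mat m m" by (simp add: A3_def)
  have block: "A' = four_block_mat ?E (0\<^sub>m 1 m) (0\<^sub>m m 1) A3"
  proof (rule eq_matI)
    fix i j assume "i < dim_row (four_block_mat ?E (0\<^sub>m 1 m) (0\<^sub>m m 1) A3)"
      "j < dim_col (four_block_mat ?E (0\<^sub>m 1 m) (0\<^sub>m m 1) A3)"
    then have "i < n" "j < n" using A3 n by auto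
    then show "A' $$ (i, j) = four_block_mat ?E (0\<^sub>m 1 m) (0\<^sub>m m 1) A3 $$ (i, j)"
      using A3 n col0[of i] col0[of j] row0[of j]
      by (auto simp: A3_def)
  qed (use A' A3 n in auto)
  have "similar_mat A A'"
    unfolding similar_mat_def
    by (intro exI, rule similar_mat_witI[of W "mat_adjoint W" n])
      (use A A' Wc WW A_eq in auto)
  then have "char_poly A' = [:- of_real e, 1:] * ?p" by (simp add: char_poly_similar[symmetric] cp)
  moreover have "char_poly A' = char_poly ?E * char_poly A3"
    unfolding block by (rule char_poly_four_block_zeros_col) (use A3 in auto)
  moreover have "char_poly ?E = [:- of_real e, 1:]"
    by (simp add: char_poly_defs det_def sign_def)
  ultimately have cp3: "char_poly A3 = ?p"
    by (metis mult_cancel_left pCons_eq_0_iff zero_neq_one)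
  have "hermitian_mat m A3"
    unfolding hermitian_mat_iff
  proof (intro conjI allI impI)
    fix i j assume "i < m" "j < m"
    then show "A3 $$ (i, j) = cnj (A3 $$ (j, i))"
      unfolding A3_def using herm'[of "Suc i" "Suc j"] n by simp
  qed (rule A3)
  from Cons.IH[OF this cp3] obtain U3 where U3: "unitary_mat m U3"
    and A3eq: "A3 = U3 * mat_diag m (\<lambda>i. of_real (es ! i)) * mat_adjoint U3" by blast
  have U3c: "U3 \<in> carrier_mat m m" "mat_adjoint U3 \<in> carrier_mat m m"
    and U3U: "mat_adjoint U3 * U3 = 1\<^sub>m m"
    using U3 by (auto simp: unitary_mat_def)
  define F where "F = four_block_mat (1\<^sub>m 1) (0\<^sub>m 1 m) (0\<^sub>m m 1) U3"
  have Fc: "F \<in> carrier_mat n n" 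
    unfolding F_def n by (rule four_block_carrier_mat) (use U3c in auto)
  have adjF: "mat_adjoint F = four_block_mat (1\<^sub>m 1) (0\<^sub>m 1 m) (0\<^sub>m m 1) (mat_adjoint U3)"
    using U3c by (intro eq_matI) (auto simp: F_def)
  have Fu: "unitary_mat n F"
  proof (rule unitary_matI[OF Fc])
    show "mat_adjoint F * F = 1\<^sub>m n"
      unfolding adjF unfolding F_def
      by (subst mult_four_block_mat[of _ 1 1 _ m _ m _ _ 1 _ m])
        (use U3c U3U n in \<open>auto simp: four_block_one_mat\<close>)
  qed
  let ?D3 = "mat_diag m (\<lambda>i. complex_of_real (es ! i))"
  have D: "mat_diag n (\<lambda>i. complex_of_real ((e # es) ! i)) =
      four_block_mat ?E (0\<^sub>m 1 m) (0\<^sub>m m 1) ?D3"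
    by (rule eq_matI) (auto simp: mat_diag_def n nth_Cons')
  have "A' = F * mat_diag n (\<lambda>i. of_real ((e # es) ! i)) * mat_adjoint F"
  proof -
    have FD: "F * mat_diag n (\<lambda>i. of_real ((e # es) ! i)) =
        four_block_mat ?E (0\<^sub>m 1 m) (0\<^sub>m m 1) (U3 * ?D3)"
      unfolding D F_def
      by (subst mult_four_block_mat[of _ 1 1 _ m _ m _ _ 1 _ m])
        (use U3c in \<open>auto simp: left_mult_zero_mat[OF mat_diag_dim]\<close>)
    have UD: "U3 * ?D3 \<in> carrier_mat m m" "U3 * ?D3 * mat_adjoint U3 \<in> carrier_mat m m"
      using U3c mat_diag_dim by (blast intro: mult_carrier_mat)+
    show ?thesis
      unfolding FD adjF block A3eq
      by (subst mult_four_block_mat[of _ 1 1 _ m _ m _ _ 1 _ m])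
        (use U3c UD(2) in \<open>auto simp: right_mult_zero_mat[OF UD(1)]\<close>)
  qed
  then have "A = W * (F * mat_diag n (\<lambda>i. of_real ((e # es) ! i)) * mat_adjoint F) * mat_adjoint W"
    using A_eq by simp
  also have "\<dots> = (W * F) * mat_diag n (\<lambda>i. of_real ((e # es) ! i)) * mat_adjoint (W * F)"
    using Wc Fc by (simp add: mat_adjoint_mult[of _ n n _ n] mult_carrier_mat[of _ n n _ n] assoc_mult_mat[of _ n n _ n _ n])
  finally show ?case using unitary_mat_mult[OF W Fu] by blast
qed

lemma hermitian_eigenvalue_real:
  assumes "hermitian_mat n A" "eigenvalue A k"
  shows "Im k = 0"
proof -
  have A: "A \<in> carrier_mat n n" and adj: "\<And>i j. i < n \<Longrightarrow> j < n \<Longrightarrow> A $$ (i, j) = cnj (A $$ (j, i))"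
    using assms(1) unfolding hermitian_mat_iff by blast+
  obtain v where v: "v \<in> carrier_vec n" "v \<noteq> 0\<^sub>v n" and ev: "A *\<^sub>v v = k \<cdot>\<^sub>v v"
    using assms(2) A unfolding eigenvalue_def eigenvector_def by auto
  let ?q = "\<Sum>i<n. \<Sum>j<n. A $$ (i, j) * v $ j * cnj (v $ i)"
  have "?q = (A *\<^sub>v v) \<bullet>c v"
    using A v by (simp add: scalar_prod_def atLeast0LessThan sum_distrib_right)
  also have "\<dots> = k * (v \<bullet>c v)" using v by (simp add: ev)
  finally have q: "?q = k * (v \<bullet>c v)" .
  have "cnj ?q = (\<Sum>i<n. \<Sum>j<n. A $$ (j, i) * v $ i * cnj (v $ j))"
    unfolding cnj_sum
  proof (intro sum.cong refl)
    fix i j assume "i \<in> {..<n}" "j \<in> {..<n}"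
    then show "cnj (A $$ (i, j) * v $ j * cnj (v $ i)) = A $$ (j, i) * v $ i * cnj (v $ j)"
      using adj[of j i] by simp
  qed
  also have "\<dots> = ?q" by (rule sum.swap)
  finally have "cnj ?q = ?q" .
  moreover have "Im z = 0" if "cnj z = z" for z using that by (simp add: complex_eq_iff)
  ultimately have "Im ?q = 0" by blast
  moreover have "0 < v \<bullet>c v" using v by simp
  ultimately show ?thesis unfolding q by (auto simp: less_complex_def complex_eq_iff)
qed

lemma proots_linear_factors: "proots (\<Prod>a\<leftarrow>as. [:- a, 1:]) = mset (as :: complex list)"
proof (induction as)
  case (Cons a as)
  have "(\<Prod>a\<leftarrow>as. [:- a, 1:]) \<noteq> 0" by (auto simp: prod_list_zero_iff)
  then show ?case using Cons by (simp add: proots_mult del: mult_pCons_left)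
qed simp

text \<open>
  The eigenvalues of a Hermitian matrix are real, so taking real parts in the list of eigenvalues
  loses nothing and the list still splits the characteristic polynomial.
\<close>

lemma hermitian_spectral_decomposition:
  assumes "hermitian_mat n A"
  obtains U where "unitary_mat n U"
    and "\<And>i j. i < n \<Longrightarrow> j < n \<Longrightarrow>
      A $$ (i, j) = (\<Sum>k<n. of_real (sorted_eigenvalues A ! k) * U $$ (i, k) * cnj (U $$ (j, k)))"
    and "length (sorted_eigenvalues A) = n"
proof -
  have A: "A \<in> carrier_mat n n" using assms by (simp add: hermitian_mat_def)
  obtain as where as: "char_poly A = (\<Prod>a\<leftarrow>as. [:- a, 1:])" "length as = n"
    using char_poly_factorized[OF A] by blast
  have real: "of_real (Re a) = a" if "a \<in> set as" for a
  proof -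
    have "poly (char_poly A) a = 0" using that by (auto simp: as poly_prod_list prod_list_zero_iff)
    then have "Im a = 0"
      using hermitian_eigenvalue_real[OF assms] by (simp add: eigenvalue_root_char_poly[OF A])
    then show ?thesis by (simp add: complex_eq_iff)
  qed
  have "proots (char_poly A) = mset as"
    unfolding as(1) by (rule proots_linear_factors)
  then have ms: "mset (sorted_eigenvalues A) = image_mset Re (mset as)"
    by (simp add: sorted_eigenvalues_def)
  have len: "length (sorted_eigenvalues A) = n"
    using arg_cong[OF ms, of size] as(2) by simp
  have "(\<Prod>e\<leftarrow>sorted_eigenvalues A. [:- complex_of_real e, 1:]) =
      prod_mset (image_mset (\<lambda>e. [:- complex_of_real e, 1:]) (mset (sorted_eigenvalues A)))"
    by (simp flip: mset_map add: prod_mset_prod_list)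
  also have "\<dots> = prod_mset (image_mset (\<lambda>a. [:- a, 1:]) (mset as))"
    unfolding ms using real
    by (auto simp: image_mset.compositionality o_def intro!: arg_cong[of _ _ prod_mset] image_mset_cong)
  also have "\<dots> = char_poly A" by (simp flip: mset_map add: prod_mset_prod_list as)
  finally obtain U where U: "unitary_mat n U"
    and eq: "A = U * mat_diag n (\<lambda>i. of_real (sorted_eigenvalues A ! i)) * mat_adjoint U"
    using hermitian_unitary_diagonalization[OF assms] by metis
  have Uc: "U \<in> carrier_mat n n" using U by (simp add: unitary_mat_def)
  have "A $$ (i, j) = (\<Sum>k<n. of_real (sorted_eigenvalues A ! k) * U $$ (i, k) * cnj (U $$ (j, k)))"
    if "i < n" "j < n" for i j
    by (subst eq, subst mat_diag_mult_right[OF Uc])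
      (use Uc that in \<open>auto simp: scalar_prod_def atLeast0LessThan mult_ac intro!: sum.cong\<close>)
  then show thesis using that[OF U _ len] by blast
qed

section \<open>Quadratic forms and traces\<close>

definition quad_form :: "complex mat \<Rightarrow> complex vec \<Rightarrow> real" where
  "quad_form A x = Re ((A *\<^sub>v x) \<bullet>c x)"

lemma quad_form_expand:
  assumes "A \<in> carrier_mat n n" "x \<in> carrier_vec n"
  shows "quad_form A x = Re (\<Sum>i<n. \<Sum>j<n. A $$ (i, j) * x $ j * cnj (x $ i))"
  using assms by (simp add: quad_form_def scalar_prod_def atLeast0LessThan sum_distrib_right)

lemma mat_trace_mult:
  assumes "A \<in> carrier_mat n n" "B \<in> carrier_mat n n"
  shows "mat_trace (A * B) = (\<Sum>i<n. \<Sum>j<n. A $$ (i, j) * B $$ (j, i))"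
  using assms by (auto simp: mat_trace_def scalar_prod_def atLeast0LessThan intro!: sum.cong)

lemma unitary_mat_entries:
  assumes "unitary_mat n U" "i < n" "j < n"
  shows "(\<Sum>k<n. cnj (U $$ (k, i)) * U $$ (k, j)) = (if i = j then 1 else 0)"
    and "(\<Sum>k<n. U $$ (i, k) * cnj (U $$ (j, k))) = (if i = j then 1 else 0)"
proof -
  have U: "U \<in> carrier_mat n n" "mat_adjoint U * U = 1\<^sub>m n" "U * mat_adjoint U = 1\<^sub>m n"
    using assms by (auto simp: unitary_mat_def)
  have "(\<Sum>k<n. cnj (U $$ (k, i)) * U $$ (k, j)) = (mat_adjoint U * U) $$ (i, j)"
    using U(1) assms by (auto simp: scalar_prod_def atLeast0LessThan intro!: sum.cong)
  then show "(\<Sum>k<n. cnj (U $$ (k, i)) * U $$ (k, j)) = (if i = j then 1 else 0)"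
    using assms by (simp add: U)
  have "(\<Sum>k<n. U $$ (i, k) * cnj (U $$ (j, k))) = (U * mat_adjoint U) $$ (i, j)"
    using U(1) assms by (auto simp: scalar_prod_def atLeast0LessThan intro!: sum.cong)
  then show "(\<Sum>k<n. U $$ (i, k) * cnj (U $$ (j, k))) = (if i = j then 1 else 0)"
    using assms by (simp add: U)
qed

text \<open>
  Writing \<open>A\<close> as a weighted sum of rank-one matrices \<open>u u*\<close> turns the trace of \<open>A * X\<close> into a weighted sum
  of values of the quadratic form of \<open>X\<close>. In an eigenbasis of \<open>A\<close>
  this reduces inequalities for traces to inequalities for the weights.
\<close>

lemma trace_mult_spectral:
  fixes d :: "nat \<Rightarrow> real"
  assumes U: "U \<in> carrier_mat n n" and A: "A \<in> carrier_mat n n" and X: "X \<in> carrier_mat n n"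
    and eq: "\<And>i j. i < n \<Longrightarrow> j < n \<Longrightarrow>
      A $$ (i, j) = (\<Sum>k<n. of_real (d k) * U $$ (i, k) * cnj (U $$ (j, k)))"
  shows "Re (mat_trace (A * X)) = (\<Sum>k<n. d k * quad_form X (col U k))"
proof -
  have "mat_trace (A * X) =
      (\<Sum>i<n. \<Sum>j<n. \<Sum>k<n. of_real (d k) * (X $$ (j, i) * U $$ (i, k) * cnj (U $$ (j, k))))"
    unfolding mat_trace_mult[OF A X]
    by (intro sum.cong refl) (simp add: eq sum_distrib_left sum_distrib_right mult_ac)
  also have "\<dots> = (\<Sum>i<n. \<Sum>k<n. \<Sum>j<n. of_real (d k) * (X $$ (j, i) * U $$ (i, k) * cnj (U $$ (j, k))))"
    by (rule sum.cong[OF refl], rule sum.swap)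
  also have "\<dots> = (\<Sum>k<n. \<Sum>i<n. \<Sum>j<n. of_real (d k) * (X $$ (j, i) * U $$ (i, k) * cnj (U $$ (j, k))))"
    by (rule sum.swap)
  also have "\<dots> = (\<Sum>k<n. \<Sum>j<n. \<Sum>i<n. of_real (d k) * (X $$ (j, i) * U $$ (i, k) * cnj (U $$ (j, k))))"
    by (rule sum.cong[OF refl], rule sum.swap)
  also have "\<dots> = (\<Sum>k<n. of_real (d k) *
      (\<Sum>j<n. \<Sum>i<n. X $$ (j, i) * U $$ (i, k) * cnj (U $$ (j, k))))"
    by (simp add: sum_distrib_left)
  finally have "Re (mat_trace (A * X)) = (\<Sum>k<n. d k *
      Re (\<Sum>j<n. \<Sum>i<n. X $$ (j, i) * U $$ (i, k) * cnj (U $$ (j, k))))"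
    by (simp only: Re_sum) (simp add: Re_complex_of_real)
  also have "\<dots> = (\<Sum>k<n. d k * quad_form X (col U k))"
    using U by (intro sum.cong refl) (simp add: quad_form_expand[OF X, of "col U _"])
  finally show ?thesis .
qed

lemma trace_unitary:
  assumes U: "unitary_mat n U" and X: "X \<in> carrier_mat n n"
  shows "Re (mat_trace X) = (\<Sum>k<n. quad_form X (col U k))"
  using trace_mult_spectral[of U n "1\<^sub>m n" X "\<lambda>_. 1"] U X unitary_mat_entries(2)[OF U]
  by (simp add: unitary_mat_def)

lemma quad_form_eigenvector:
  assumes U: "unitary_mat n U" and A: "A \<in> carrier_mat n n"
    and eq: "\<And>i j. i < n \<Longrightarrow> j < n \<Longrightarrow>
      A $$ (i, j) = (\<Sum>k<n. of_real (d k) * U $$ (i, k) * cnj (U $$ (j, k)))"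
    and k: "k < n"
  shows "A *\<^sub>v col U k = of_real (d k) \<cdot>\<^sub>v col U k"
    and "quad_form A (col U k) = d k"
proof -
  have Uc: "U \<in> carrier_mat n n" using U by (simp add: unitary_mat_def)
  show ev: "A *\<^sub>v col U k = of_real (d k) \<cdot>\<^sub>v col U k"
  proof (rule eq_vecI)
    fix i assume "i < dim_vec (of_real (d k) \<cdot>\<^sub>v col U k)"
    then have i: "i < n" using Uc by simp
    have "(A *\<^sub>v col U k) $ i = (\<Sum>j<n. A $$ (i, j) * U $$ (j, k))"
      using i k A Uc by (simp add: scalar_prod_def atLeast0LessThan)
    also have "\<dots> = (\<Sum>j<n. \<Sum>l<n. of_real (d l) * U $$ (i, l) * (cnj (U $$ (j, l)) * U $$ (j, k)))"
      using i by (intro sum.cong refl) (simp add: eq sum_distrib_left sum_distrib_right mult_ac)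
    also have "\<dots> = (\<Sum>l<n. of_real (d l) * U $$ (i, l) * (\<Sum>j<n. cnj (U $$ (j, l)) * U $$ (j, k)))"
      unfolding sum_distrib_left by (rule sum.swap)
    also have "\<dots> = (\<Sum>l<n. if l = k then of_real (d l) * U $$ (i, l) else 0)"
      using k by (intro sum.cong refl) (simp add: unitary_mat_entries(1)[OF U])
    also have "\<dots> = (of_real (d k) \<cdot>\<^sub>v col U k) $ i" using i k Uc by simp
    finally show "(A *\<^sub>v col U k) $ i = (of_real (d k) \<cdot>\<^sub>v col U k) $ i" .
  qed (use A Uc in auto)
  have "col U k \<bullet>c col U k = (\<Sum>j<n. cnj (U $$ (j, k)) * U $$ (j, k))"
    using k Uc by (simp add: scalar_prod_def atLeast0LessThan mult.commute)
  also have "\<dots> = 1" using unitary_mat_entries(1)[OF U k k] by simp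
  finally show "quad_form A (col U k) = d k" using Uc k by (simp add: quad_form_def ev)
qed

section \<open>Positive semidefinite matrices\<close>

lemma quad_form_nonneg: "psd_mat n X \<Longrightarrow> x \<in> carrier_vec n \<Longrightarrow> 0 \<le> quad_form X x"
  by (simp add: psd_mat_def quad_form_def)

text \<open>
  In an eigenbasis of \<open>A\<close>, each value of the quadratic form of \<open>X\<close> is at most their sum, which is
  the trace of \<open>X\<close>.
\<close>

lemma trace_mult_psd_le:
  assumes A: "psd_mat n A" and X: "psd_mat n X"
  shows "Re (mat_trace (A * X)) \<le> Re (mat_trace A) * Re (mat_trace X)"
proof -
  have herm: "hermitian_mat n A" and Ac: "A \<in> carrier_mat n n" and Xc: "X \<in> carrier_mat n n"
    using A X by (auto simp: psd_mat_def hermitian_mat_def)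
  obtain U where U: "unitary_mat n U" and eq: "\<And>i j. i < n \<Longrightarrow> j < n \<Longrightarrow>
      A $$ (i, j) = (\<Sum>k<n. of_real (sorted_eigenvalues A ! k) * U $$ (i, k) * cnj (U $$ (j, k)))"
    using hermitian_spectral_decomposition[OF herm] by metis
  have Uc: "U \<in> carrier_mat n n" using U by (simp add: unitary_mat_def)
  let ?d = "\<lambda>k. sorted_eigenvalues A ! k" and ?q = "\<lambda>k. quad_form X (col U k)"
  have col: "col U k \<in> carrier_vec n" if "k < n" for k using Uc that by auto
  have d: "quad_form A (col U k) = ?d k" if "k < n" for k
    by (rule quad_form_eigenvector(2)[OF U Ac eq that])
  have "Re (mat_trace (A * X)) = (\<Sum>k<n. ?d k * ?q k)"
    by (rule trace_mult_spectral[OF Uc Ac Xc eq])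
  also have "\<dots> \<le> (\<Sum>k<n. ?d k * (\<Sum>k<n. ?q k))"
    using d quad_form_nonneg[OF A col] quad_form_nonneg[OF X col]
    by (intro sum_mono mult_left_mono member_le_sum) (metis lessThan_iff | simp)+
  also have "\<dots> = (\<Sum>k<n. quad_form A (col U k)) * (\<Sum>k<n. ?q k)"
    by (simp add: sum_distrib_right d)
  also have "\<dots> = Re (mat_trace A) * Re (mat_trace X)"
    by (simp add: trace_unitary[OF U Ac] trace_unitary[OF U Xc])
  finally show ?thesis .
qed

lemma frobenius_norm_sq:
  assumes "X \<in> carrier_mat n n"
  shows "(frobenius_norm X)\<^sup>2 = (\<Sum>i<n. \<Sum>j<n. (cmod (X $$ (i, j)))\<^sup>2)"
  using assms by (simp add: frobenius_norm_def sum_nonneg)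

text \<open>
  The squared Frobenius norm of a Hermitian matrix is the trace of its square.
\<close>

lemma frobenius_le_trace_psd:
  assumes X: "psd_mat n X"
  shows "(frobenius_norm X)\<^sup>2 \<le> (Re (mat_trace X))\<^sup>2"
proof -
  have Xc: "X \<in> carrier_mat n n" and adj: "\<And>i j. i < n \<Longrightarrow> j < n \<Longrightarrow> X $$ (i, j) = cnj (X $$ (j, i))"
    using X unfolding psd_mat_def hermitian_mat_iff by blast+
  have "mat_trace (X * X) = (\<Sum>i<n. \<Sum>j<n. of_real ((cmod (X $$ (i, j)))\<^sup>2))"
    unfolding mat_trace_mult[OF Xc Xc]
  proof (intro sum.cong refl)
    fix i j assume "i \<in> {..<n}" "j \<in> {..<n}"
    then have "X $$ (j, i) = cnj (X $$ (i, j))" by (intro adj) auto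
    then show "X $$ (i, j) * X $$ (j, i) = of_real ((cmod (X $$ (i, j)))\<^sup>2)"
      by (simp only: complex_norm_square)
  qed
  then have "(frobenius_norm X)\<^sup>2 = Re (mat_trace (X * X))"
    by (simp add: frobenius_norm_sq[OF Xc])
  also have "\<dots> \<le> (Re (mat_trace X))\<^sup>2"
    using trace_mult_psd_le[OF X X] by (simp add: power2_eq_square)
  finally show ?thesis .
qed

section \<open>Rank and the spectral gap\<close>

text \<open>
  Each summand is a matrix of rank at most one, and the rank is subadditive.
\<close>

lemma rank_le_number_of_products:
  fixes A :: "complex mat" and f g :: "nat \<Rightarrow> nat \<Rightarrow> complex"
  assumes A: "A \<in> carrier_mat n nc" and K: "finite K"
    and eq: "\<And>i j. i < n \<Longrightarrow> j < nc \<Longrightarrow> A $$ (i, j) = (\<Sum>k\<in>K. f k i * g k j)"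
  shows "vec_space.rank n A \<le> card K"
  using K A eq
proof (induction K arbitrary: A)
  case empty
  then have "A = 0\<^sub>m n nc" by (intro eq_matI) auto
  then show ?case by (simp add: vec_space.rank_0I)
next
  case (insert k K)
  let ?B = "mat n nc (\<lambda>(i, j). f k i * g k j)"
    and ?C = "mat n nc (\<lambda>(i, j). \<Sum>k\<in>K. f k i * g k j)"
  have "A = ?B + ?C"
    using insert.prems insert.hyps by (intro eq_matI) auto
  then have "vec_space.rank n A \<le> vec_space.rank n ?B + vec_space.rank n ?C"
    using vec_space.rank_subadditive[of ?B n nc ?C] by simp
  also have "vec_space.rank n ?B \<le> 1"
    by (rule vec_space.rank_le_1_product_entries[where nc = nc and f = "f k" and g = "g k"]) auto
  also have "vec_space.rank n ?C \<le> card K" by (rule insert.IH) auto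
  finally show ?case using insert.hyps by simp
qed

lemma cscalar_prod_col:
  assumes "U \<in> carrier_mat n n" "k < n" "v \<in> carrier_vec n"
  shows "v \<bullet>c col U k = (\<Sum>j<n. cnj (U $$ (j, k)) * v $ j)"
  using assms by (simp add: scalar_prod_def atLeast0LessThan mult.commute)

lemma sorted_eigenvalues_mono:
  assumes "hermitian_mat n H" "i \<le> j" "j < n"
  shows "sorted_eigenvalues H ! i \<le> sorted_eigenvalues H ! j"
proof -
  have "length (sorted_eigenvalues H) = n"
    using hermitian_spectral_decomposition[OF assms(1)] by metis
  then show ?thesis
    using assms(2,3) by (intro sorted_nth_mono) (auto simp: sorted_eigenvalues_def)
qed

lemma psd_eigenvalue_nonneg:
  assumes H: "psd_mat n H" and k: "k < n"
  shows "0 \<le> sorted_eigenvalues H ! k"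
proof -
  have herm: "hermitian_mat n H" and Hc: "H \<in> carrier_mat n n"
    using H by (auto simp: psd_mat_def hermitian_mat_def)
  obtain U where U: "unitary_mat n U"
    and eq: "\<And>i j. i < n \<Longrightarrow> j < n \<Longrightarrow>
      H $$ (i, j) = (\<Sum>k<n. of_real (sorted_eigenvalues H ! k) * U $$ (i, k) * cnj (U $$ (j, k)))"
    using hermitian_spectral_decomposition[OF herm] by metis
  have "col U k \<in> carrier_vec n" using U k by (auto simp: unitary_mat_def)
  from quad_form_nonneg[OF H this] show ?thesis
    using quad_form_eigenvector(2)[OF U Hc eq k] by simp
qed

text \<open>
  A psd matrix of rank \<open>n - 1\<close> has only one vanishing eigenvalue: were the two smallest both
  zero, the remaining \<open>n - 2\<close> terms of the spectral decomposition would bound the rank by \<open>n - 2\<close>.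
\<close>

lemma second_smallest_eigenvalue_pos:
  assumes n: "2 \<le> n" and H: "psd_mat n H" and rank: "vec_space.rank n H = n - 1"
  shows "0 < second_smallest_eigenvalue H"
proof -
  have herm: "hermitian_mat n H" and Hc: "H \<in> carrier_mat n n"
    using H by (auto simp: psd_mat_def hermitian_mat_def)
  define d where "d k = sorted_eigenvalues H ! k" for k
  obtain U where
    eq: "\<And>i j. i < n \<Longrightarrow> j < n \<Longrightarrow>
      H $$ (i, j) = (\<Sum>k<n. of_real (d k) * U $$ (i, k) * cnj (U $$ (j, k)))"
    using hermitian_spectral_decomposition[OF herm] unfolding d_def by metis
  have dnn: "0 \<le> d k" if "k < n" for k
    unfolding d_def by (rule psd_eigenvalue_nonneg[OF H that])
  have mono: "d i \<le> d j" if "i \<le> j" "j < n" for i j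
    unfolding d_def by (rule sorted_eigenvalues_mono[OF herm that])
  have gap: "0 < d 1"
  proof (rule ccontr)
    assume "\<not> 0 < d 1"
    then have z: "d 0 = 0" "d 1 = 0" using dnn[of 0] dnn[of 1] mono[of 0 1] n by auto
    have "vec_space.rank n H \<le> card {2..<n}"
    proof (rule rank_le_number_of_products[OF Hc])
      fix i j assume "i < n" "j < n"
      then have "H $$ (i, j) = (\<Sum>k<n. of_real (d k) * U $$ (i, k) * cnj (U $$ (j, k)))"
        by (rule eq)
      also have "\<dots> = (\<Sum>k\<in>{2..<n}. of_real (d k) * U $$ (i, k) * cnj (U $$ (j, k)))"
      proof (rule sum.mono_neutral_right)
        show "\<forall>k\<in>{..<n} - {2..<n}. of_real (d k) * U $$ (i, k) * cnj (U $$ (j, k)) = 0"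
        proof
          fix k assume "k \<in> {..<n} - {2..<n}"
          then have "k = 0 \<or> k = 1" by auto
          then show "of_real (d k) * U $$ (i, k) * cnj (U $$ (j, k)) = 0" using z by auto
        qed
      qed auto
      finally show "H $$ (i, j) = (\<Sum>k\<in>{2..<n}. (of_real (d k) * U $$ (i, k)) * cnj (U $$ (j, k)))" .
    qed simp
    then show False using rank n by simp
  qed
  then show ?thesis by (simp add: second_smallest_eigenvalue_def d_def)
qed

text \<open>
  If the second smallest eigenvalue \<open>\<lambda>\<close> of \<open>H\<close> is positive, a null vector \<open>v\<close> of \<open>H\<close> is orthogonal
  to every eigenvector except the one of the smallest eigenvalue, hence a multiple of that one.
  In the trace of \<open>H * X\<close> the other eigenvectors together carry the trace of \<open>X\<close> minus its part
  along \<open>v\<close>, each with a weight of at least \<open>\<lambda>\<close>. The difference measures how far \<open>X\<close> is from the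
  rank-one matrices on \<open>v\<close>.
\<close>

lemma psd_spectral_gap:
  assumes n: "2 \<le> n" and H: "psd_mat n H" and v: "v \<in> carrier_vec n" "v \<noteq> 0\<^sub>v n"
    and Hv: "H *\<^sub>v v = 0\<^sub>v n" and pos: "0 < second_smallest_eigenvalue H"
    and X: "psd_mat n X"
  shows "second_smallest_eigenvalue H * (Re (mat_trace X) - quad_form X v / Re (v \<bullet>c v))
    \<le> Re (mat_trace (H * X))"
proof -
  have herm: "hermitian_mat n H" and Hc: "H \<in> carrier_mat n n"
    using H by (auto simp: psd_mat_def hermitian_mat_def)
  define d where "d k = sorted_eigenvalues H ! k" for k
  obtain U where U: "unitary_mat n U"
    and eq: "\<And>i j. i < n \<Longrightarrow> j < n \<Longrightarrow>
      H $$ (i, j) = (\<Sum>k<n. of_real (d k) * U $$ (i, k) * cnj (U $$ (j, k)))"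
    using hermitian_spectral_decomposition[OF herm] unfolding d_def by metis
  have dnn: "0 \<le> d k" if "k < n" for k
    unfolding d_def by (rule psd_eigenvalue_nonneg[OF H that])
  have mono: "d i \<le> d j" if "i \<le> j" "j < n" for i j
    unfolding d_def by (rule sorted_eigenvalues_mono[OF herm that])
  have gap: "0 < d 1" using pos by (simp add: second_smallest_eigenvalue_def d_def)
  have Uc: "U \<in> carrier_mat n n" using U by (simp add: unitary_mat_def)
  have col: "col U k \<in> carrier_vec n" if "k < n" for k using Uc that by auto
  \<comment> \<open>the coordinates of \<open>v\<close> in the eigenbasis\<close>
  define c where "c k = v \<bullet>c col U k" for k
  have expand: "v $ i = (\<Sum>k<n. c k * U $$ (i, k))" if i: "i < n" for i
  proof -
    have "(\<Sum>k<n. c k * U $$ (i, k)) = (\<Sum>k<n. \<Sum>j<n. U $$ (i, k) * cnj (U $$ (j, k)) * v $ j)"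
      using Uc v by (intro sum.cong refl) (simp add: c_def cscalar_prod_col sum_distrib_left mult_ac)
    also have "\<dots> = (\<Sum>j<n. (\<Sum>k<n. U $$ (i, k) * cnj (U $$ (j, k))) * v $ j)"
      unfolding sum_distrib_right by (rule sum.swap)
    also have "\<dots> = (\<Sum>j<n. if j = i then v $ j else 0)"
      using i by (intro sum.cong refl) (simp add: unitary_mat_entries(2)[OF U])
    also have "\<dots> = v $ i" using i by simp
    finally show ?thesis by simp
  qed
  have c0: "c k = 0" if k: "0 < k" "k < n" for k
  proof -
    have dk: "d k \<noteq> 0" using mono[of 1 k] gap k by auto
    \<comment> \<open>the coordinate of \<open>H v\<close> along the eigenvector \<open>k\<close>, moving \<open>H\<close> to the other side\<close>
    have "of_real (d k) * c k = 0"
    proof -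
      have Hvi: "(\<Sum>j<n. H $$ (i, j) * v $ j) = 0" if "i < n" for i
        using arg_cong[OF Hv, of "\<lambda>x. x $ i"] that Hc v
        by (simp add: scalar_prod_def atLeast0LessThan)
      have "of_real (d k) * c k = (\<Sum>j<n. cnj (of_real (d k) * U $$ (j, k)) * v $ j)"
        using Uc v k by (simp add: c_def cscalar_prod_col sum_distrib_left mult_ac)
      also have "\<dots> = (\<Sum>j<n. \<Sum>i<n. cnj (U $$ (i, k)) * (H $$ (i, j) * v $ j))"
      proof (intro sum.cong refl)
        fix j assume "j \<in> {..<n}"
        then have j: "j < n" by simp
        have "of_real (d k) * U $$ (j, k) = (H *\<^sub>v col U k) $ j"
          using quad_form_eigenvector(1)[OF U Hc eq k(2)] Uc j k by simp
        also have "\<dots> = (\<Sum>i<n. H $$ (j, i) * U $$ (i, k))"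
          using Hc Uc j k by (simp add: scalar_prod_def atLeast0LessThan)
        finally have "cnj (of_real (d k) * U $$ (j, k)) = (\<Sum>i<n. cnj (H $$ (j, i)) * cnj (U $$ (i, k)))"
          by (simp only: cnj_sum complex_cnj_mult)
        also have "\<dots> = (\<Sum>i<n. H $$ (i, j) * cnj (U $$ (i, k)))"
        proof (intro sum.cong refl)
          fix i assume "i \<in> {..<n}"
          then have "H $$ (i, j) = cnj (H $$ (j, i))"
            using herm j unfolding hermitian_mat_iff by blast
          then show "cnj (H $$ (j, i)) * cnj (U $$ (i, k)) = H $$ (i, j) * cnj (U $$ (i, k))"
            by (simp only:)
        qed
        finally show "cnj (of_real (d k) * U $$ (j, k)) * v $ j =
            (\<Sum>i<n. cnj (U $$ (i, k)) * (H $$ (i, j) * v $ j))"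
          by (simp only: sum_distrib_left sum_distrib_right mult_ac)
      qed
      also have "\<dots> = (\<Sum>i<n. cnj (U $$ (i, k)) * (\<Sum>j<n. H $$ (i, j) * v $ j))"
        unfolding sum_distrib_left by (rule sum.swap)
      also have "\<dots> = 0" using Hvi by simp
      finally show ?thesis .
    qed
    then show ?thesis using dk by simp
  qed
  let ?u = "col U 0"
  have n0: "0 < n" using n by simp
  have v_eq: "v = c 0 \<cdot>\<^sub>v ?u"
  proof (rule eq_vecI)
    fix i assume "i < dim_vec (c 0 \<cdot>\<^sub>v ?u)"
    then have i: "i < n" using Uc by simp
    have "v $ i = (\<Sum>k<n. if k = 0 then c 0 * U $$ (i, 0) else 0)"
      unfolding expand[OF i] by (intro sum.cong refl) (simp add: c0)
    also have "\<dots> = (c 0 \<cdot>\<^sub>v ?u) $ i" using n0 i Uc by simp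
    finally show "v $ i = (c 0 \<cdot>\<^sub>v ?u) $ i" .
  qed (use v Uc in auto)
  have cne: "c 0 \<noteq> 0"
  proof
    assume "c 0 = 0"
    then have "v = 0\<^sub>v n" using v_eq Uc by auto
    then show False using v by simp
  qed
  have uu: "?u \<bullet>c ?u = 1"
    using unitary_mat_entries(1)[OF U n0 n0] Uc n0
    by (simp add: cscalar_prod_col[OF Uc n0 col[OF n0]])
  have scale: "(a \<cdot>\<^sub>v x) \<bullet>c (b \<cdot>\<^sub>v z) = a * cnj b * (x \<bullet>c z)"
    if "x \<in> carrier_vec n" "z \<in> carrier_vec n" for a b x z
    using that by (simp add: conjugate_smult_vec mult_ac)
  have vv: "Re (v \<bullet>c v) = (cmod (c 0))\<^sup>2"
  proof -
    have "v \<bullet>c v = c 0 * cnj (c 0) * 1"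
      by (subst (1 2) v_eq, subst scale) (use col[OF n0] uu in auto)
    then show ?thesis by (simp flip: complex_norm_square)
  qed
  have Xc: "X \<in> carrier_mat n n" using X by (auto simp: psd_mat_def hermitian_mat_def)
  let ?q = "\<lambda>k. quad_form X (col U k)"
  have qv: "quad_form X v = (cmod (c 0))\<^sup>2 * ?q 0"
  proof -
    have "(X *\<^sub>v v) \<bullet>c v = c 0 * cnj (c 0) * ((X *\<^sub>v ?u) \<bullet>c ?u)"
      by (subst (1 2) v_eq, subst mult_mat_vec[OF Xc col[OF n0]], subst scale)
        (use Xc col[OF n0] in auto)
    then show ?thesis unfolding quad_form_def by (simp flip: complex_norm_square of_real_power)
  qed
  have "Re (mat_trace X) - quad_form X v / Re (v \<bullet>c v) = (\<Sum>k<n. ?q k) - ?q 0"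
    unfolding vv qv using cne by (simp add: trace_unitary[OF U Xc])
  also have "\<dots> = (\<Sum>k\<in>{..<n} - {0}. ?q k)" using n0 by (simp add: sum_diff1)
  finally have "d 1 * (Re (mat_trace X) - quad_form X v / Re (v \<bullet>c v)) =
      (\<Sum>k\<in>{..<n} - {0}. d 1 * ?q k)" by (simp only: sum_distrib_left)
  also have "\<dots> \<le> (\<Sum>k\<in>{..<n} - {0}. d k * ?q k)"
    using mono[of 1] quad_form_nonneg[OF X col] by (intro sum_mono mult_right_mono) auto
  also have "\<dots> \<le> (\<Sum>k<n. d k * ?q k)"
    using dnn quad_form_nonneg[OF X col] by (intro sum_mono2) auto
  also have "\<dots> = Re (mat_trace (H * X))"
    by (rule trace_mult_spectral[OF Uc Hc Xc eq, symmetric])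
  finally show "second_smallest_eigenvalue H * (Re (mat_trace X) - quad_form X v / Re (v \<bullet>c v))
      \<le> Re (mat_trace (H * X))"
    by (simp add: second_smallest_eigenvalue_def d_def)
qed

section \<open>Distance to a rank-one matrix\<close>

lemma outer_prod_carrier: "u \<in> carrier_vec m \<Longrightarrow> w \<in> carrier_vec n \<Longrightarrow> outer_prod u w \<in> carrier_mat m n"
  by (auto simp: outer_prod_def)

lemma psd_outer_prod:
  assumes v: "v \<in> carrier_vec n"
  shows "psd_mat n (outer_prod v v)"
  unfolding psd_mat_def
proof (intro conjI ballI)
  show "hermitian_mat n (outer_prod v v)"
    using v by (simp add: hermitian_mat_iff outer_prod_carrier) (simp add: outer_prod_def)
  fix x :: "complex vec" assume x: "x \<in> carrier_vec n"
  have "(outer_prod v v *\<^sub>v x) \<bullet>c x =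
      (\<Sum>i<n. \<Sum>j<n. v $ i * cnj (v $ j) * x $ j * cnj (x $ i))"
    using v x by (simp add: outer_prod_def scalar_prod_def atLeast0LessThan sum_distrib_right)
  also have "\<dots> = (\<Sum>i<n. v $ i * cnj (x $ i)) * cnj (\<Sum>j<n. v $ j * cnj (x $ j))"
    unfolding cnj_sum sum_product by (intro sum.cong refl) simp
  also have "\<dots> = of_real ((cmod (\<Sum>i<n. v $ i * cnj (x $ i)))\<^sup>2)"
    by (simp only: complex_norm_square)
  finally show "0 \<le> Re ((outer_prod v v *\<^sub>v x) \<bullet>c x)" by simp
qed

lemma trace_mult_outer_prod:
  assumes A: "A \<in> carrier_mat n n" and v: "v \<in> carrier_vec n"
  shows "Re (mat_trace (A * outer_prod v v)) = quad_form A v"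
  unfolding quad_form_expand[OF A v] mat_trace_mult[OF A outer_prod_carrier[OF v v]]
  by (intro arg_cong[of _ _ Re] sum.cong refl) (use v in \<open>auto simp: outer_prod_def\<close>)

text \<open>
  Expansion of the square in the Frobenius inner product: the inner product of \<open>X\<close>
  with \<open>v v*\<close> is the quadratic form of \<open>X\<close> at \<open>v\<close>.
\<close>

lemma frobenius_norm_rank_one_deviation:
  fixes \<beta> :: real
  assumes X: "X \<in> carrier_mat n n" and v: "v \<in> carrier_vec n"
  shows "(frobenius_norm (X - of_real \<beta> \<cdot>\<^sub>m outer_prod v v))\<^sup>2 =
    (frobenius_norm X)\<^sup>2 - 2 * \<beta> * quad_form X v + (\<beta> * Re (v \<bullet>c v))\<^sup>2"
proof -
  have Y: "X - of_real \<beta> \<cdot>\<^sub>m outer_prod v v \<in> carrier_mat n n"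
    using outer_prod_carrier[OF v v] by (intro minus_carrier_mat smult_carrier_mat)
  have sq: "(cmod (z - of_real b * (a * cnj c)))\<^sup>2 =
      (cmod z)\<^sup>2 - 2 * b * Re (z * c * cnj a) + b\<^sup>2 * ((cmod a)\<^sup>2 * (cmod c)\<^sup>2)" for z a c b
    unfolding cmod_power2 by (simp add: power2_eq_square algebra_simps)
  have vv: "Re (v \<bullet>c v) = (\<Sum>i<n. (cmod (v $ i))\<^sup>2)"
    using v by (simp add: scalar_prod_def atLeast0LessThan flip: complex_norm_square of_real_power)
  have "(frobenius_norm (X - of_real \<beta> \<cdot>\<^sub>m outer_prod v v))\<^sup>2 =
      (\<Sum>i<n. \<Sum>j<n. (cmod (X $$ (i, j)))\<^sup>2 - 2 * \<beta> * Re (X $$ (i, j) * v $ j * cnj (v $ i))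
        + \<beta>\<^sup>2 * ((cmod (v $ i))\<^sup>2 * (cmod (v $ j))\<^sup>2))"
    unfolding frobenius_norm_sq[OF Y]
  proof (intro sum.cong refl)
    fix i j assume "i \<in> {..<n}" "j \<in> {..<n}"
    then have "(X - of_real \<beta> \<cdot>\<^sub>m outer_prod v v) $$ (i, j) =
        X $$ (i, j) - of_real \<beta> * (v $ i * cnj (v $ j))"
      using X v by (simp add: outer_prod_def)
    then show "(cmod ((X - of_real \<beta> \<cdot>\<^sub>m outer_prod v v) $$ (i, j)))\<^sup>2 =
        (cmod (X $$ (i, j)))\<^sup>2 - 2 * \<beta> * Re (X $$ (i, j) * v $ j * cnj (v $ i))
          + \<beta>\<^sup>2 * ((cmod (v $ i))\<^sup>2 * (cmod (v $ j))\<^sup>2)"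
      by (simp only: sq)
  qed
  also have "\<dots> = (frobenius_norm X)\<^sup>2 - 2 * \<beta> * quad_form X v
      + \<beta>\<^sup>2 * ((\<Sum>i<n. (cmod (v $ i))\<^sup>2) * (\<Sum>j<n. (cmod (v $ j))\<^sup>2))"
    unfolding frobenius_norm_sq[OF X] quad_form_expand[OF X v] sum_product
    by (simp only: sum.distrib sum_subtractf sum_distrib_left Re_sum)
  finally show ?thesis by (simp add: vv power_mult_distrib power2_eq_square)
qed

text \<open>
  With \<open>T\<close> the trace of \<open>X\<close> and \<open>a\<close> the value of its quadratic form at the normalized \<open>v\<close>, the
  multiple of \<open>v v*\<close> that has trace \<open>T\<close> lies at the squared distance
  \<open>\<parallel>X\<parallel>\<^sup>2 - 2 * T * a + T\<^sup>2 \<le> 2 * T * (T - a)\<close>. The orthogonal projection of \<open>X\<close>, of trace \<open>a\<close>,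
  is nearer, but its coefficient can be zero; matching the traces costs nothing in the
  final estimate and keeps the coefficient positive as long as \<open>X \<noteq> 0\<close>.
\<close>

lemma psd_near_rank_one:
  assumes X: "psd_mat n X" and v: "v \<in> carrier_vec n" "v \<noteq> 0\<^sub>v n"
  defines "T \<equiv> Re (mat_trace X)"
  shows "(frobenius_norm (X - of_real (T / Re (v \<bullet>c v)) \<cdot>\<^sub>m outer_prod v v))\<^sup>2
    \<le> 2 * T * (T - quad_form X v / Re (v \<bullet>c v))"
proof -
  have Xc: "X \<in> carrier_mat n n" using X by (auto simp: psd_mat_def hermitian_mat_def)
  have "0 < v \<bullet>c v" using v by simp
  then have vv: "0 < Re (v \<bullet>c v)" by (simp add: less_complex_def)
  have "(frobenius_norm (X - of_real (T / Re (v \<bullet>c v)) \<cdot>\<^sub>m outer_prod v v))\<^sup>2 =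
      (frobenius_norm X)\<^sup>2 - 2 * T * (quad_form X v / Re (v \<bullet>c v)) + T\<^sup>2"
    unfolding frobenius_norm_rank_one_deviation[OF Xc v(1)] using vv by simp
  also have "\<dots> \<le> T\<^sup>2 - 2 * T * (quad_form X v / Re (v \<bullet>c v)) + T\<^sup>2"
    using frobenius_le_trace_psd[OF X] by (simp add: T_def)
  also have "\<dots> = 2 * T * (T - quad_form X v / Re (v \<bullet>c v))"
    by (simp add: power2_eq_square algebra_simps)
  finally show ?thesis .
qed

section \<open>The penalized program\<close>

lemma trace_dual_mat_mult:
  assumes M0: "M0 \<in> carrier_mat n n" and Ms: "\<And>j. j < m \<Longrightarrow> Ms j \<in> carrier_mat n n"
    and X: "X \<in> carrier_mat n n"
  shows "Re (mat_trace (dual_mat n m M0 Ms \<mu> * X)) =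
    Re (mat_trace (M0 * X)) + (\<Sum>j<m. \<mu> $ j * Re (mat_trace (Ms j * X)))"
proof -
  have H: "dual_mat n m M0 Ms \<mu> \<in> carrier_mat n n" by (simp add: dual_mat_def)
  have "mat_trace (dual_mat n m M0 Ms \<mu> * X) =
      (\<Sum>i<n. \<Sum>k<n. M0 $$ (i, k) * X $$ (k, i) + (\<Sum>j<m. of_real (\<mu> $ j) * (Ms j $$ (i, k) * X $$ (k, i))))"
    unfolding mat_trace_mult[OF H X]
    by (intro sum.cong refl) (simp add: dual_mat_def distrib_right sum_distrib_right mult.assoc)
  also have "\<dots> = mat_trace (M0 * X) +
      (\<Sum>i<n. \<Sum>k<n. \<Sum>j<m. of_real (\<mu> $ j) * (Ms j $$ (i, k) * X $$ (k, i)))"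
    unfolding mat_trace_mult[OF M0 X] by (simp only: sum.distrib)
  also have "(\<Sum>i<n. \<Sum>k<n. \<Sum>j<m. of_real (\<mu> $ j) * (Ms j $$ (i, k) * X $$ (k, i))) =
      (\<Sum>i<n. \<Sum>j<m. \<Sum>k<n. of_real (\<mu> $ j) * (Ms j $$ (i, k) * X $$ (k, i)))"
    by (rule sum.cong[OF refl], rule sum.swap)
  also have "\<dots> = (\<Sum>j<m. \<Sum>i<n. \<Sum>k<n. of_real (\<mu> $ j) * (Ms j $$ (i, k) * X $$ (k, i)))"
    by (rule sum.swap)
  also have "\<dots> = (\<Sum>j<m. of_real (\<mu> $ j) * mat_trace (Ms j * X))"
    using Ms X by (intro sum.cong refl) (simp add: mat_trace_mult[of _ n] sum_distrib_left)
  finally show ?thesis by simp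
qed

text \<open>
  The true state gives the feasible point \<open>(v v*, \<eta>)\<close>, so optimality bounds the objective at
  \<open>(X, \<nu>)\<close>. Both points satisfy the measurement equations with the same data, and the dual matrix
  annihilates \<open>v\<close>; hence the difference of the values of \<open>M0\<close> is the trace sought, up to
  the term \<open>\<Sum>j. \<mu> j * (\<eta> j - \<nu> j)\<close>. The bound on \<open>\<rho>\<close> makes the penalty dominate this term: its
  \<open>\<nu>\<close> part is cancelled by the penalty of \<open>\<nu>\<close>, and its \<open>\<eta>\<close> part doubles the penalty of \<open>\<eta>\<close>.
\<close>

lemma trace_dual_mat_optimal_le:
  assumes M0: "M0 \<in> carrier_mat n n" and Ms: "\<And>j. j < m \<Longrightarrow> Ms j \<in> carrier_mat n n"
    and v: "v \<in> carrier_vec n" and Hv: "dual_mat n m M0 Ms \<mu> *\<^sub>v v = 0\<^sub>v n"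
    and \<sigma>: "\<And>j. j < m \<Longrightarrow> 0 < \<sigma> j"
    and \<rho>: "\<And>j. j < m \<Longrightarrow> \<bar>\<sigma> j * \<mu> $ j\<bar> \<le> \<rho>"
    and \<eta>: "\<eta> \<in> carrier_vec m"
    and opt: "is_arg_min (penalized_objective m \<sigma> M0 \<rho>)
      (penalized_feasible n m Ms (noisy_meas m Ms v \<eta>)) (X, \<nu>)"
  shows "Re (mat_trace (dual_mat n m M0 Ms \<mu> * X)) \<le> 2 * \<rho> * f_WLAV m \<sigma> \<eta>"
proof -
  let ?H = "dual_mat n m M0 Ms \<mu>" and ?z = "noisy_meas m Ms v \<eta>" and ?V = "outer_prod v v"
  have V: "?V \<in> carrier_mat n n" by (rule outer_prod_carrier[OF v v])
  have Hc: "?H \<in> carrier_mat n n" by (simp add: dual_mat_def)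
  have feas: "penalized_feasible n m Ms ?z (X, \<nu>)"
    and le: "penalized_objective m \<sigma> M0 \<rho> (X, \<nu>) \<le> penalized_objective m \<sigma> M0 \<rho> (X', \<nu>')"
    if "penalized_feasible n m Ms ?z (X', \<nu>')" for X' \<nu>'
    using opt that by (auto simp: is_arg_min_linorder)
  have "penalized_feasible n m Ms ?z (?V, \<eta>)"
    using psd_outer_prod[OF v] \<eta> Ms v
    by (auto simp: penalized_feasible_def psd_mat_def noisy_meas_def trace_mult_outer_prod[of _ n] quad_form_def)
  note feas = feas[OF this] and le = le[OF this]
  have X: "X \<in> carrier_mat n n"
    using feas by (auto simp: penalized_feasible_def hermitian_mat_def)
  have resid: "Re (mat_trace (Ms j * X)) = Re (mat_trace (Ms j * ?V)) + \<eta> $ j - \<nu> $ j" if "j < m" for j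
    using feas that Ms[OF that] v
    by (auto simp: penalized_feasible_def noisy_meas_def trace_mult_outer_prod[of _ n] quad_form_def)
  have "Re (mat_trace (?H * ?V)) = 0"
    using v by (simp add: trace_mult_outer_prod[OF Hc v] quad_form_def Hv)
  then have HV: "Re (mat_trace (M0 * ?V)) + (\<Sum>j<m. \<mu> $ j * Re (mat_trace (Ms j * ?V))) = 0"
    by (simp add: trace_dual_mat_mult[OF M0 Ms V])
  have "Re (mat_trace (?H * X)) = Re (mat_trace (M0 * X))
      + (\<Sum>j<m. \<mu> $ j * Re (mat_trace (Ms j * ?V))) + (\<Sum>j<m. \<mu> $ j * (\<eta> $ j - \<nu> $ j))"
    by (simp add: trace_dual_mat_mult[OF M0 Ms X] resid algebra_simps sum.distrib sum_subtractf)
  also have "\<dots> \<le> \<rho> * f_WLAV m \<sigma> \<eta> - \<rho> * f_WLAV m \<sigma> \<nu> + (\<Sum>j<m. \<mu> $ j * (\<eta> $ j - \<nu> $ j))"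
    using le HV by (simp add: penalized_objective_def)
  also have "(\<Sum>j<m. \<mu> $ j * (\<eta> $ j - \<nu> $ j)) \<le> (\<Sum>j<m. \<rho> * (\<bar>\<eta> $ j\<bar> / \<sigma> j) + \<rho> * (\<bar>\<nu> $ j\<bar> / \<sigma> j))"
  proof (rule sum_mono)
    fix j assume "j \<in> {..<m}"
    then have j: "j < m" by simp
    have "\<bar>\<mu> $ j\<bar> \<le> \<rho> / \<sigma> j" using \<rho>[OF j] \<sigma>[OF j] by (simp add: abs_mult field_simps)
    then have "\<bar>\<mu> $ j\<bar> * \<bar>\<eta> $ j - \<nu> $ j\<bar> \<le> \<rho> / \<sigma> j * (\<bar>\<eta> $ j\<bar> + \<bar>\<nu> $ j\<bar>)"
      by (intro mult_mono) auto
    moreover have "\<mu> $ j * (\<eta> $ j - \<nu> $ j) \<le> \<bar>\<mu> $ j\<bar> * \<bar>\<eta> $ j - \<nu> $ j\<bar>"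
      by (metis abs_ge_self abs_mult)
    ultimately show "\<mu> $ j * (\<eta> $ j - \<nu> $ j) \<le> \<rho> * (\<bar>\<eta> $ j\<bar> / \<sigma> j) + \<rho> * (\<bar>\<nu> $ j\<bar> / \<sigma> j)"
      by (simp add: distrib_left)
  qed
  also have "\<dots> = \<rho> * f_WLAV m \<sigma> \<eta> + \<rho> * f_WLAV m \<sigma> \<nu>"
    by (simp add: f_WLAV_def sum.distrib sum_distrib_left)
  finally show ?thesis by simp
qed

lemma connected_imp_arcs_nonempty:
  assumes "Digraph_Component.connected T" "u \<in> verts T" "w \<in> verts T" "u \<noteq> w"
  shows "arcs T \<noteq> {}"
proof
  assume no: "arcs T = {}"
  have "u \<rightarrow>\<^sup>*\<^bsub>with_proj (mk_symmetric T)\<^esub> w"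
    using assms unfolding connected_def strongly_connected_def by simp
  then have "(u, w) \<in> rtrancl_on (verts T) (parcs (mk_symmetric T))"
    by (simp add: reachable_def)
  then show False
    by (cases rule: rtrancl_on.cases) (use no assms(4) in \<open>auto simp: parcs_mk_symmetric\<close>)
qed

text \<open>
  The spanning tree inside \<open>G'\<close> connects at least two buses, so some line is measured, and the
  angle conditions at a line force the voltages at its ends to be nonzero.
\<close>

lemma power_network_state_nonzero:
  assumes N: "2 \<le> N" and net: "power_network N G G'" and a: "assumption1 N G' y M0 v"
  shows "v \<noteq> 0\<^sub>v N"
proof -
  obtain T where T: "undirected_spanning_tree T G" "subgraph T G'"
    and G: "verts G = {..<N}" "subgraph G' G"
    using net by (auto simp: power_network_def)
  have "verts T = {..<N}" "Digraph_Component.connected T"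
    using T G by (auto simp: undirected_spanning_tree_def spanning_def)
  then have "arcs T \<noteq> {}" using N connected_imp_arcs_nonempty[of T 0 1] by auto
  then obtain l where l: "l \<in> arcs G'" using T(2) by (auto simp: subgraph_def)
  have "wf_digraph G'" using G by (simp add: subgraph_def)
  then have "tail G' l \<in> verts G'" using l by (simp add: wf_digraph_def)
  then have "tail G' l < N" using G by (auto simp: subgraph_def)
  moreover have "v $ tail G' l \<noteq> 0" using a l by (simp add: assumption1_def angle_conditions_def)
  ultimately show ?thesis by auto
qed

theorem theorem2:
  fixes N M :: nat
    and G G' :: "(nat, 'l) pre_digraph"
    and ls :: "'l list"
    and y :: "'l \<Rightarrow> complex"
    and M0 X_opt :: "complex mat"
    and Ms :: "nat \<Rightarrow> complex mat"
    and v :: "complex vec"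
    and \<sigma> :: "nat \<Rightarrow> real"
    and \<mu> \<eta> z \<nu>_opt :: "real vec"
    and \<rho> lam :: real
  assumes "2 \<le> N"
    and "power_network N G G'"
    and "distinct ls" and "set ls = arcs G'"
    and M_def: "M = N + length ls"
    and Ms_def: "Ms = meas_mat N G' y ls"
    and "v \<in> carrier_vec N"
    and "hermitian_mat N M0"
    and "assumption1 N G' y M0 v"
    and "\<And>j. j < M \<Longrightarrow> 0 < \<sigma> j"
    and "\<mu> \<in> dual_certificate_set N M M0 Ms v"
    and "\<eta> \<in> carrier_vec M"
    and z_def: "z = noisy_meas M Ms v \<eta>"
    and "0 < \<rho>"
    and "\<rho> \<ge> Max ((\<lambda>j. \<bar>\<sigma> j * \<mu> $ j\<bar>) ` {..<M})"
    and "is_arg_min (penalized_objective M \<sigma> M0 \<rho>) (penalized_feasible N M Ms z) (X_opt, \<nu>_opt)"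
    and "0 < Re (mat_trace X_opt)"
    and lam_def: "lam = second_smallest_eigenvalue (dual_mat N M M0 Ms \<mu>)"
  shows "\<exists>\<beta>::real. 0 < \<beta> \<and>
    frobenius_norm (X_opt - complex_of_real \<beta> \<cdot>\<^sub>m outer_prod v v)
        / sqrt (real N * Re (mat_trace X_opt))
      \<le> 2 * sqrt (\<rho> * f_WLAV M \<sigma> \<eta> / (real N * lam))"
proof -
  define H where "H = dual_mat N M M0 Ms \<mu>"
  define T where "T = Re (mat_trace X_opt)"
  define r where "r = Re (v \<bullet>c v)"
  have H: "psd_mat N H" "H *\<^sub>v v = 0\<^sub>v N" "vec_space.rank N H = N - 1"
    using assms(11) by (auto simp: dual_certificate_set_def H_def)
  have v: "v \<in> carrier_vec N" by fact
  have v0: "v \<noteq> 0\<^sub>v N" by (rule power_network_state_nonzero[OF assms(1,2,9)])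
  have r: "0 < r"
  proof -
    have "0 < v \<bullet>c v" using v v0 by simp
    then show ?thesis by (simp add: r_def less_complex_def)
  qed
  have T: "0 < T" using assms(17) by (simp add: T_def)
  have M0: "M0 \<in> carrier_mat N N" using assms(8) by (simp add: hermitian_mat_def)
  have Ms: "Ms j \<in> carrier_mat N N" for j
    by (simp add: Ms_def meas_mat_def flow_mat_def outer_prod_carrier)
  have X: "psd_mat N X_opt"
    using assms(16) by (auto simp: is_arg_min_def penalized_feasible_def)
  have \<rho>: "\<bar>\<sigma> j * \<mu> $ j\<bar> \<le> \<rho>" if "j < M" for j
    by (rule order.trans[OF Max_ge assms(15)]) (use that in auto)
  have lam: "0 < lam"
    using second_smallest_eigenvalue_pos[OF assms(1) H(1,3)] by (simp add: lam_def H_def)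
  have "lam * (T - quad_form X_opt v / r) \<le> Re (mat_trace (H * X_opt))"
    using psd_spectral_gap[OF assms(1) H(1) v v0 H(2) _ X] lam
    by (simp add: lam_def H_def T_def r_def)
  also have "\<dots> \<le> 2 * \<rho> * f_WLAV M \<sigma> \<eta>"
    unfolding H_def
    by (rule trace_dual_mat_optimal_le[OF M0 Ms v _ assms(10) \<rho> assms(12) assms(16)[unfolded z_def]])
      (use H(2) in \<open>simp_all add: H_def\<close>)
  finally have gap: "T - quad_form X_opt v / r \<le> 2 * \<rho> * f_WLAV M \<sigma> \<eta> / lam"
    using lam by (simp add: field_simps)
  let ?Y = "X_opt - complex_of_real (T / r) \<cdot>\<^sub>m outer_prod v v"
  have "(frobenius_norm ?Y)\<^sup>2 \<le> 2 * T * (T - quad_form X_opt v / r)"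
    using psd_near_rank_one[OF X v v0] by (simp add: T_def r_def)
  also have "\<dots> \<le> 2 * T * (2 * \<rho> * f_WLAV M \<sigma> \<eta> / lam)"
    using gap T by (intro mult_left_mono) auto
  finally have bound: "(frobenius_norm ?Y)\<^sup>2 \<le> 2 * T * (2 * \<rho> * f_WLAV M \<sigma> \<eta> / lam)" .
  have NT: "0 < real N * T" using assms(1) T by simp
  have "frobenius_norm ?Y / sqrt (real N * T) = sqrt ((frobenius_norm ?Y)\<^sup>2 / (real N * T))"
    by (simp add: real_sqrt_divide frobenius_norm_def sum_nonneg)
  also have "\<dots> \<le> sqrt (2 * T * (2 * \<rho> * f_WLAV M \<sigma> \<eta> / lam) / (real N * T))"
    using bound NT by (intro real_sqrt_le_mono divide_right_mono) auto
  also have "2 * T * (2 * \<rho> * f_WLAV M \<sigma> \<eta> / lam) / (real N * T)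
      = 2\<^sup>2 * (\<rho> * f_WLAV M \<sigma> \<eta> / (real N * lam))"
    using T lam assms(1) by (simp add: field_simps)
  also have "sqrt \<dots> = 2 * sqrt (\<rho> * f_WLAV M \<sigma> \<eta> / (real N * lam))"
    by (simp only: real_sqrt_mult real_sqrt_abs abs_numeral)
  finally have "frobenius_norm ?Y / sqrt (real N * T) \<le> 2 * sqrt (\<rho> * f_WLAV M \<sigma> \<eta> / (real N * lam))" .
  then show ?thesis using T r by (intro exI[of _ "T / r"]) (simp add: T_def)
qed

end
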